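(* Let $R\subseteq E$ be Lie conformal algebras ($R$ a subalgebra of $E$), and let $Q$ be a complement of $R$ in $E$, with associated matched pair of Lie conformal algebras $(R,Q,\lhd_\lambda,\rhd_\lambda)$. Then $\equiv$ is an equivalence relation on the set $\mathcal{DM}(Q,R\mid(\lhd_\lambda,\rhd_\lambda))$ of deformation maps, and the map $$\mathcal{HL}^2(Q,R\mid(\lhd_\lambda,\rhd_\lambda)):=\mathcal{DM}(Q,R\mid(\lhd_\lambda,\rhd_\lambda))/\equiv\ \longrightarrow\ \mathcal{F}(R,E),\qquad \overline{\varphi}\mapsto Q_\varphi,$$ sending the class $\overline{\varphi}$ of $\varphi$ to the isomorphism class of complements of $R$ in $E$ that are isomorphic to $Q_\varphi$, is a bijection between $\mathcal{HL}^2(Q,R\mid(\lhd_\lambda,\rhd_\lambda))$ and the set $\mathcal{F}(R,E)$ of isomorphism classes of complements of $R$ in $E$.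
   Context: All vector spaces are over $\mathbb{C}$. A Lie conformal algebra is a $\mathbb{C}[\partial]$-module $R$ with a $\mathbb{C}$-bilinear map $[\cdot_\lambda\cdot]: R\times R\to R[\lambda]$ satisfying $[\partial a_\lambda b]=-\lambda[a_\lambda b]$, $[a_\lambda \partial b]=(\partial+\lambda)[a_\lambda b]$, $[a_\lambda b]=-[b_{-\lambda-\partial}a]$ and $[a_\lambda[b_\mu c]]=[[a_\lambda b]_{\lambda+\mu}c]+[b_\mu[a_\lambda c]]$ for all $a,b,c\in R$. Convention: if $u\ast_\lambda v=\sum_n \lambda^n w_n$, then $u\ast_{-\lambda-\partial}v:=\sum_n(-\lambda-\partial)^n w_n$. $\mathbb{C}[\partial]$-module maps are extended coefficientwise to polynomials in $\lambda$. Homomorphisms of Lie conformal algebras are $\mathbb{C}[\partial]$-module maps preserving $\lambda$-brackets. A complement of a subalgebra $R$ in $E$ is a subalgebra $Q$ of $E$ such that $E=R\oplus Q$ as $\mathbb{C}[\partial]$-modules. $\mathcal{F}(R,E)$ denotes the set of isomorphism classes (as Lie conformal algebras) of complements of $R$ in $E$. Elements of $E=R\oplus Q$ are written $a\oplus x$ with $a\in R$, $x\in Q$. The associated matched pair $(R,Q,\lhd_\lambda,\rhd_\lambda)$ consists of the operations $\rhd_\lambda: Q\times R\to R[\lambda]$ and $\lhd_\lambda: Q\times R\to Q[\lambda]$ determined by $[x_\lambda a]=(x\rhd_\lambda a)\oplus(x\lhd_\lambda a)$ for $x\in Q$, $a\in R$. The bracket of $E$ is then that of the bicrossed product of $R$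 and $Q$: $$[(a\oplus x)_\lambda (b\oplus y)]=([a_\lambda b]+x\rhd_\lambda b-y\rhd_{-\lambda-\partial} a)\oplus([x_\lambda y]+x\lhd_\lambda b-y\lhd_{-\lambda-\partial} a).$$ A deformation map of $(R,Q,\lhd_\lambda,\rhd_\lambda)$ is a $\mathbb{C}[\partial]$-module homomorphism $\varphi:Q\to R$ such that for all $x,y\in Q$ $$\varphi([x_\lambda y])-[\varphi(x)_\lambda\varphi(y)]=\varphi(y\lhd_{-\lambda-\partial}\varphi(x))-\varphi(x\lhd_\lambda\varphi(y))+x\rhd_\lambda\varphi(y)-y\rhd_{-\lambda-\partial}\varphi(x).$$ The set of all deformation maps is $\mathcal{DM}(Q,R\mid(\lhd_\lambda,\rhd_\lambda))$. For a deformation map $\varphi$, the $\varphi$-deformation $Q_\varphi$ of $Q$ is the $\mathbb{C}[\partial]$-module $Q$ with the $\lambda$-bracket $[x_\lambda y]_\varphi:=[x_\lambda y]+x\lhd_\lambda\varphi(y)-y\lhd_{-\lambda-\partial}\varphi(x)$, which is a Lie conformal algebra isomorphic to the complement $\{\varphi(x)\oplus x: x\in Q\}$ of $R$ in $E$. Two deformation maps $\varphi,\phi:Q\to R$ are equivalent, written $\varphi\equiv\phi$, if there is a $\mathbb{C}[\partial]$-module isomorphism $\alpha:Q\to Q$ such that for all $x,y\in Q$ $$\alpha([x_\lambda y])-[\alpha(x)_\lambda\alpha(y)]=\alpha(x)\lhd_\lambda\phi(\alpha(y))-\alpha(x\lhd_\lambda\varphi(y))-\alpha(y)\lhd_{-\lambda-\partial}\phi(\alpha(x))+\alpha(y\lhd_{-\lambda-\partial}\varphi(x)).$$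 *)

theory Defs
  imports Complex_Main "HOL-Computational_Algebra.Polynomial" "HOL-Library.FuncSet"
begin

text \<open>
  A \<open>\<complex>[\<partial>]\<close>-module is a \<^locale>\<open>module\<close> over the ring \<^typ>\<open>complex poly\<close>: the indeterminate
  \<open>[:0, 1:]\<close> acts as \<open>\<partial>\<close> and the constants \<open>[:k:]\<close> give the complex scalars.
  For a module on the type \<open>'e\<close>, the space \<open>R[\<lambda>]\<close> is the type \<open>'e poly\<close>: multiplication by
  \<open>\<lambda>\<close> is \<open>pCons 0\<close>, and \<open>map_poly f\<close> is the coefficientwise extension of a map \<open>f\<close> with \<open>f 0 = 0\<close>.
\<close>

definition del :: "(complex poly \<Rightarrow> 'e \<Rightarrow> 'e) \<Rightarrow> 'e \<Rightarrow> 'e"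
  where "del scale v = scale [:0, 1:] v"

text \<open>
  Substitution of an operator for the variable: \<open>\<Sum>n. \<lambda>\<^sup>n w\<^sub>n\<close> is sent to \<open>\<Sum>n. T\<^sup>n (g w\<^sub>n)\<close>,
  where \<open>g\<close> says how the coefficients are to be read in the target.
\<close>

definition subst_op :: "('b \<Rightarrow> 'b) \<Rightarrow> ('a \<Rightarrow> 'b) \<Rightarrow> 'a::zero poly \<Rightarrow> 'b::comm_monoid_add"
  where "subst_op T g w = (\<Sum>n\<le>degree w. (T ^^ n) (g (coeff w n)))"

text \<open>The value at \<open>-\<lambda>-\<partial>\<close>: the sum \<open>\<Sum>n. \<lambda>\<^sup>n w\<^sub>n\<close> is sent to \<open>\<Sum>n. (-\<lambda>-\<partial>)\<^sup>n w\<^sub>n\<close>.\<close>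

definition at_neg :: "(complex poly \<Rightarrow> 'e \<Rightarrow> 'e) \<Rightarrow> 'e::ab_group_add poly \<Rightarrow> 'e poly"
  where "at_neg scale w =
    subst_op (\<lambda>q. - pCons 0 q - map_poly (del scale) q) (\<lambda>v. [:v:]) w"

text \<open>
  \<open>R[\<lambda>,\<mu>]\<close> is \<open>'e poly poly\<close>, with \<open>\<lambda>\<close> the outer and \<open>\<mu>\<close> the inner variable.
\<close>

definition mult_lam :: "'e::zero poly poly \<Rightarrow> 'e poly poly"
  where "mult_lam = pCons 0"

definition mult_mu :: "'e::zero poly poly \<Rightarrow> 'e poly poly"
  where "mult_mu = map_poly (pCons 0)"

definition const2 :: "'e::zero \<Rightarrow> 'e poly poly"
  where "const2 v = [:[:v:]:]"

text \<open>
  In \<open>jacobi\<close>, the three summands are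
  \<open>[a\<^sub>\<lambda> [b\<^sub>\<mu> c]]\<close>, \<open>[[a\<^sub>\<lambda> b] c]\<close> at \<open>\<lambda>+\<mu>\<close>, and \<open>[b\<^sub>\<mu> [a\<^sub>\<lambda> c]]\<close>; in each of them the outer
  \<^const>\<open>subst_op\<close> runs over the coefficients of the inner bracket.
\<close>

locale lie_conformal_algebra = module scale
  for scale :: "complex poly \<Rightarrow> 'e::ab_group_add \<Rightarrow> 'e" +
  fixes br :: "'e \<Rightarrow> 'e \<Rightarrow> 'e poly"
  assumes add_left: "br (a + b) c = br a c + br b c"
    and add_right: "br a (b + c) = br a b + br a c"
    and scale_left: "br (scale [:k:] a) b = map_poly (scale [:k:]) (br a b)"
    and scale_right: "br a (scale [:k:] b) = map_poly (scale [:k:]) (br a b)"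
    and del_left: "br (del scale a) b = - pCons 0 (br a b)"
    and del_right: "br a (del scale b) = map_poly (del scale) (br a b) + pCons 0 (br a b)"
    and skew: "br a b = - at_neg scale (br b a)"
    and jacobi:
      "subst_op mult_mu (\<lambda>v. subst_op mult_lam const2 (br a v)) (br b c)
       = subst_op mult_lam (\<lambda>v. subst_op (\<lambda>q. mult_lam q + mult_mu q) const2 (br v c)) (br a b)
       + subst_op mult_lam (\<lambda>v. subst_op mult_mu const2 (br b v)) (br a c)"

definition polys_over :: "'e::zero set \<Rightarrow> 'e poly set"
  where "polys_over S = {p. \<forall>n. coeff p n \<in> S}"

definition subalgebra ::
  "(complex poly \<Rightarrow> 'e::ab_group_add \<Rightarrow> 'e) \<Rightarrow> ('e \<Rightarrow> 'e \<Rightarrow> 'e poly) \<Rightarrow> 'e set \<Rightarrow> bool"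
  where "subalgebra scale br S \<longleftrightarrow>
    module.subspace scale S \<and> (\<forall>a\<in>S. \<forall>b\<in>S. br a b \<in> polys_over S)"

text \<open>The algebra \<open>E\<close> is the whole type \<open>'e\<close>.\<close>

definition complement ::
  "(complex poly \<Rightarrow> 'e::ab_group_add \<Rightarrow> 'e) \<Rightarrow> ('e \<Rightarrow> 'e \<Rightarrow> 'e poly) \<Rightarrow> 'e set \<Rightarrow> 'e set \<Rightarrow> bool"
  where "complement scale br R Q \<longleftrightarrow>
    subalgebra scale br Q \<and> R \<inter> Q = {0} \<and> (\<forall>v. \<exists>a\<in>R. \<exists>x\<in>Q. v = a + x)"

definition dmod_hom ::
  "(complex poly \<Rightarrow> 'e::ab_group_add \<Rightarrow> 'e) \<Rightarrow> 'e set \<Rightarrow> 'e set \<Rightarrow> ('e \<Rightarrow> 'e) \<Rightarrow> bool"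
  where "dmod_hom scale S T f \<longleftrightarrow>
    f \<in> S \<rightarrow> T \<and> (\<forall>x\<in>S. \<forall>y\<in>S. f (x + y) = f x + f y)
    \<and> (\<forall>p. \<forall>x\<in>S. f (scale p x) = scale p (f x))"

text \<open>
  Isomorphism of the Lie conformal algebras with underlying submodules \<open>S\<close>, \<open>T\<close> and
  \<open>\<lambda>\<close>-brackets \<open>brS\<close>, \<open>brT\<close>, which need not be restrictions of one common bracket.
\<close>

definition lca_isomorphic ::
  "(complex poly \<Rightarrow> 'e::ab_group_add \<Rightarrow> 'e) \<Rightarrow> 'e set \<Rightarrow> ('e \<Rightarrow> 'e \<Rightarrow> 'e poly)
    \<Rightarrow> 'e set \<Rightarrow> ('e \<Rightarrow> 'e \<Rightarrow> 'e poly) \<Rightarrow> bool"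
  where "lca_isomorphic scale S brS T brT \<longleftrightarrow>
    (\<exists>f. dmod_hom scale S T f \<and> bij_betw f S T
       \<and> (\<forall>x\<in>S. \<forall>y\<in>S. map_poly f (brS x y) = brT (f x) (f y)))"

definition complement_iso_rel ::
  "(complex poly \<Rightarrow> 'e::ab_group_add \<Rightarrow> 'e) \<Rightarrow> ('e \<Rightarrow> 'e \<Rightarrow> 'e poly) \<Rightarrow> 'e set \<Rightarrow> ('e set \<times> 'e set) set"
  where "complement_iso_rel scale br R =
    {(P, P'). complement scale br R P \<and> complement scale br R P' \<and> lca_isomorphic scale P br P' br}"

definition complement_classes ::
  "(complex poly \<Rightarrow> 'e::ab_group_add \<Rightarrow> 'e) \<Rightarrow> ('e \<Rightarrow> 'e \<Rightarrow> 'e poly) \<Rightarrow> 'e set \<Rightarrow> 'e set set set"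
  where "complement_classes scale br R =
    {P. complement scale br R P} // complement_iso_rel scale br R"

text \<open>
  \<open>ltri\<close> is the operation \<open>\<lhd>\<^sub>\<lambda> : Q \<times> R \<rightarrow> Q[\<lambda>]\<close> and \<open>rtri\<close> is \<open>\<rhd>\<^sub>\<lambda> : Q \<times> R \<rightarrow> R[\<lambda>]\<close>.
  Since the sum of \<open>R\<close> and \<open>Q\<close> is direct, both are determined on \<open>Q \<times> R\<close>; values elsewhere
  are irrelevant.
\<close>

definition assoc_matched_pair ::
  "('e::ab_group_add \<Rightarrow> 'e \<Rightarrow> 'e poly) \<Rightarrow> 'e set \<Rightarrow> 'e set
    \<Rightarrow> ('e \<Rightarrow> 'e \<Rightarrow> 'e poly) \<Rightarrow> ('e \<Rightarrow> 'e \<Rightarrow> 'e poly) \<Rightarrow> bool"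
  where "assoc_matched_pair br R Q ltri rtri \<longleftrightarrow>
    (\<forall>x\<in>Q. \<forall>a\<in>R. rtri x a \<in> polys_over R \<and> ltri x a \<in> polys_over Q \<and> br x a = rtri x a + ltri x a)"

text \<open>
  Maps with domain \<open>Q\<close> are represented extensionally, so that equality in this set is
  equality of maps \<open>Q \<rightarrow> R\<close>.
\<close>

definition deformation_maps ::
  "(complex poly \<Rightarrow> 'e::ab_group_add \<Rightarrow> 'e) \<Rightarrow> ('e \<Rightarrow> 'e \<Rightarrow> 'e poly) \<Rightarrow> 'e set \<Rightarrow> 'e set
    \<Rightarrow> ('e \<Rightarrow> 'e \<Rightarrow> 'e poly) \<Rightarrow> ('e \<Rightarrow> 'e \<Rightarrow> 'e poly) \<Rightarrow> ('e \<Rightarrow> 'e) set"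
  where "deformation_maps scale br Q R ltri rtri =
    {\<phi> \<in> extensional Q. dmod_hom scale Q R \<phi> \<and>
      (\<forall>x\<in>Q. \<forall>y\<in>Q.
        map_poly \<phi> (br x y) - br (\<phi> x) (\<phi> y)
        = map_poly \<phi> (at_neg scale (ltri y (\<phi> x))) - map_poly \<phi> (ltri x (\<phi> y))
          + rtri x (\<phi> y) - at_neg scale (rtri y (\<phi> x)))}"

definition deformed_bracket ::
  "(complex poly \<Rightarrow> 'e::ab_group_add \<Rightarrow> 'e) \<Rightarrow> ('e \<Rightarrow> 'e \<Rightarrow> 'e poly)
    \<Rightarrow> ('e \<Rightarrow> 'e \<Rightarrow> 'e poly) \<Rightarrow> ('e \<Rightarrow> 'e) \<Rightarrow> 'e \<Rightarrow> 'e \<Rightarrow> 'e poly"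
  where "deformed_bracket scale br ltri \<phi> x y =
    br x y + ltri x (\<phi> y) - at_neg scale (ltri y (\<phi> x))"

definition deformation_equiv ::
  "(complex poly \<Rightarrow> 'e::ab_group_add \<Rightarrow> 'e) \<Rightarrow> ('e \<Rightarrow> 'e \<Rightarrow> 'e poly) \<Rightarrow> 'e set
    \<Rightarrow> ('e \<Rightarrow> 'e \<Rightarrow> 'e poly) \<Rightarrow> ('e \<Rightarrow> 'e) \<Rightarrow> ('e \<Rightarrow> 'e) \<Rightarrow> bool"
  where "deformation_equiv scale br Q ltri \<phi> \<psi> \<longleftrightarrow>
    (\<exists>\<alpha>. dmod_hom scale Q Q \<alpha> \<and> bij_betw \<alpha> Q Q \<and>
      (\<forall>x\<in>Q. \<forall>y\<in>Q.
        map_poly \<alpha> (br x y) - br (\<alpha> x) (\<alpha> y)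
        = ltri (\<alpha> x) (\<psi> (\<alpha> y)) - map_poly \<alpha> (ltri x (\<phi> y))
          - at_neg scale (ltri (\<alpha> y) (\<psi> (\<alpha> x))) + map_poly \<alpha> (at_neg scale (ltri y (\<phi> x)))))"

definition deformation_rel ::
  "(complex poly \<Rightarrow> 'e::ab_group_add \<Rightarrow> 'e) \<Rightarrow> ('e \<Rightarrow> 'e \<Rightarrow> 'e poly) \<Rightarrow> 'e set \<Rightarrow> 'e set
    \<Rightarrow> ('e \<Rightarrow> 'e \<Rightarrow> 'e poly) \<Rightarrow> ('e \<Rightarrow> 'e \<Rightarrow> 'e poly) \<Rightarrow> (('e \<Rightarrow> 'e) \<times> ('e \<Rightarrow> 'e)) set"
  where "deformation_rel scale br Q R ltri rtri =
    {(\<phi>, \<psi>). \<phi> \<in> deformation_maps scale br Q R ltri rtri \<and> \<psi> \<in> deformation_maps scale br Q R ltri rtri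
      \<and> deformation_equiv scale br Q ltri \<phi> \<psi>}"

definition HL2 ::
  "(complex poly \<Rightarrow> 'e::ab_group_add \<Rightarrow> 'e) \<Rightarrow> ('e \<Rightarrow> 'e \<Rightarrow> 'e poly) \<Rightarrow> 'e set \<Rightarrow> 'e set
    \<Rightarrow> ('e \<Rightarrow> 'e \<Rightarrow> 'e poly) \<Rightarrow> ('e \<Rightarrow> 'e \<Rightarrow> 'e poly) \<Rightarrow> ('e \<Rightarrow> 'e) set set"
  where "HL2 scale br Q R ltri rtri =
    deformation_maps scale br Q R ltri rtri // deformation_rel scale br Q R ltri rtri"

end

theory Submission
  imports Defs
begin

text \<open>
  The correspondence is between maps and their graphs. A \<open>\<complex>[\<partial>]\<close>-linear map \<open>\<phi> : Q \<rightarrow> R\<close> has the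
  graph \<open>{\<phi>(x) + x | x \<in> Q}\<close>, a submodule complementing \<open>R\<close>, and by elementary linear algebra
  every complementing submodule is the graph of exactly one such map
  (\<open>complement_subspace_graph\<close>). For \<open>x, y \<in> Q\<close> the \<open>\<lambda>\<close>-bracket of \<open>\<phi>(x) + x\<close> and \<open>\<phi>(y) + y\<close>
  has the \<open>Q\<close>-component \<open>[x\<^sub>\<lambda> y]\<^sub>\<phi>\<close> (\<open>bracket_on_graph\<close>), so the graph is closed under the
  bracket exactly if the \<open>R\<close>-component is the image of \<open>[x\<^sub>\<lambda> y]\<^sub>\<phi>\<close> under \<open>\<phi>\<close>. Written out, this is
  the equation of a deformation map. Thus the deformation maps correspond to the complements of \<open>R\<close>,
  and \<open>x \<mapsto> \<phi>(x) + x\<close> is an isomorphism of \<open>Q\<^sub>\<phi>\<close> onto the graph of \<open>\<phi>\<close>.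

  Rearranging the equation that defines \<open>\<phi> \<equiv> \<psi>\<close> gives
  \<open>\<alpha>([x\<^sub>\<lambda> y]\<^sub>\<phi>) = [\<alpha>(x)\<^sub>\<lambda> \<alpha>(y)]\<^sub>\<psi>\<close>, so equivalence of deformation maps is isomorphism of the
  deformations, hence of the graphs (\<open>deformation_rel_pullback\<close>). Consequently \<open>\<equiv>\<close> is the pullback
  of the isomorphism relation on complements along the surjection that takes a deformation map to
  its graph, and such a surjection induces a bijection of the quotients.
\<close>

section \<open>Polynomials with coefficients in a submodule\<close>

context
  fixes scale :: "complex poly \<Rightarrow> 'e::ab_group_add \<Rightarrow> 'e" and S :: "'e set"
  assumes mod: "module scale" and sub: "module.subspace scale S"
begin

lemma polys_over_0: "0 \<in> polys_over S"
  using module.subspace_0[OF mod sub] by (simp add: polys_over_def)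

lemma polys_over_add: "p \<in> polys_over S \<Longrightarrow> q \<in> polys_over S \<Longrightarrow> p + q \<in> polys_over S"
  using module.subspace_add[OF mod sub] by (simp add: polys_over_def)

lemma polys_over_diff: "p \<in> polys_over S \<Longrightarrow> q \<in> polys_over S \<Longrightarrow> p - q \<in> polys_over S"
  using module.subspace_diff[OF mod sub] by (simp add: polys_over_def)

lemma polys_over_uminus: "p \<in> polys_over S \<Longrightarrow> - p \<in> polys_over S"
  using module.subspace_neg[OF mod sub] by (simp add: polys_over_def)

lemma polys_over_pCons: "v \<in> S \<Longrightarrow> p \<in> polys_over S \<Longrightarrow> pCons v p \<in> polys_over S"
  by (auto simp: polys_over_def coeff_pCons split: nat.split)

lemma polys_over_map_del: "p \<in> polys_over S \<Longrightarrow> map_poly (del scale) p \<in> polys_over S"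
  using module.subspace_scale[OF mod sub] module.scale_zero_right[OF mod]
  by (auto simp: polys_over_def del_def coeff_map_poly)

lemma at_neg_polys_over:
  assumes w: "w \<in> polys_over S"
  shows "at_neg scale w \<in> polys_over S"
proof -
  let ?T = "\<lambda>q. - pCons 0 q - map_poly (del scale) q"
  have powers: "(?T ^^ n) [:v:] \<in> polys_over S" if "v \<in> S" for n v
    by (induction n)
      (simp_all add: that polys_over_0 polys_over_pCons polys_over_diff polys_over_uminus
        polys_over_map_del module.subspace_0[OF mod sub])
  have "(\<Sum>n\<in>I. (?T ^^ n) [:coeff w n:]) \<in> polys_over S" for I
  proof (induction I rule: infinite_finite_induct)
    case (insert n I)
    moreover have "coeff w n \<in> S" using w by (simp add: polys_over_def)
    ultimately show ?case
      using polys_over_add[OF powers] by simp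
  qed (simp_all add: polys_over_0)
  then show ?thesis
    by (simp add: at_neg_def subst_op_def)
qed

end

text \<open>
  The range of summation in \<open>subst_op\<close> depends on the degree of the argument; additivity follows
  by summing up to a common bound for the degrees.
\<close>

lemma subst_op_add:
  fixes T :: "'b::ab_group_add \<Rightarrow> 'b" and g :: "'a::ab_group_add \<Rightarrow> 'b"
  assumes T: "\<And>p q. T (p + q) = T p + T q" and g: "\<And>u v. g (u + v) = g u + g v"
  shows "subst_op T g (p + q) = subst_op T g p + subst_op T g q"
proof -
  have Tn: "(T ^^ n) (p + q) = (T ^^ n) p + (T ^^ n) q" for n p q
    by (induction n) (simp_all add: T)
  have h_add: "(T ^^ n) (g (u + v)) = (T ^^ n) (g u) + (T ^^ n) (g v)" for n u v
    by (simp add: g Tn)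
  have h_0: "(T ^^ n) (g 0) = 0" for n
    using h_add[of n 0 0] by simp
  define N where "N = max (degree p) (degree q)"
  have bound: "subst_op T g w = (\<Sum>n\<le>N. (T ^^ n) (g (coeff w n)))" if "degree w \<le> N" for w
    unfolding subst_op_def using that
    by (intro sum.mono_neutral_left) (auto simp: h_0 coeff_eq_0)
  have "degree (p + q) \<le> N" "degree p \<le> N" "degree q \<le> N"
    by (auto simp: N_def degree_add_le)
  then show ?thesis
    by (simp add: bound h_add sum.distrib)
qed

lemma at_neg_add:
  assumes "module scale"
  shows "at_neg scale (p + q) = at_neg scale p + at_neg scale q"
proof -
  have "map_poly (del scale) (u + v) = map_poly (del scale) u + map_poly (del scale) v" for u v
    using module.scale_zero_right[OF assms] module.scale_right_distrib[OF assms]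
    by (intro poly_eqI) (simp add: coeff_map_poly del_def)
  then show ?thesis
    unfolding at_neg_def by (intro subst_op_add) simp_all
qed

section \<open>Module homomorphisms and isomorphisms\<close>

lemma dmod_homD:
  assumes "dmod_hom scale S T f"
  shows "x \<in> S \<Longrightarrow> f x \<in> T"
    and "x \<in> S \<Longrightarrow> y \<in> S \<Longrightarrow> f (x + y) = f x + f y"
    and "x \<in> S \<Longrightarrow> f (scale p x) = scale p (f x)"
  using assms by (auto simp: dmod_hom_def)

lemma dmod_hom_0:
  fixes scale :: "complex poly \<Rightarrow> 'e::ab_group_add \<Rightarrow> 'e"
  assumes "dmod_hom scale S T f" and "0 \<in> S"
  shows "f 0 = 0"
  using dmod_homD(2)[OF assms(1) assms(2) assms(2)] by simp

lemma map_poly_hom_add: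
  fixes scale :: "complex poly \<Rightarrow> 'e::ab_group_add \<Rightarrow> 'e"
  assumes "dmod_hom scale S T f" and "0 \<in> S" and "p \<in> polys_over S" and "q \<in> polys_over S"
  shows "map_poly f (p + q) = map_poly f p + map_poly f q"
  using assms(3,4) dmod_hom_0[OF assms(1,2)] dmod_homD(2)[OF assms(1)]
  by (intro poly_eqI) (simp add: coeff_map_poly polys_over_def)

lemma map_poly_hom_diff:
  fixes scale :: "complex poly \<Rightarrow> 'e::ab_group_add \<Rightarrow> 'e"
  assumes "module scale" and "module.subspace scale S" and "dmod_hom scale S T f"
    and "p \<in> polys_over S" and "q \<in> polys_over S"
  shows "map_poly f (p - q) = map_poly f p - map_poly f q"
  using map_poly_hom_add[OF assms(3) module.subspace_0[OF assms(1,2)]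
      polys_over_diff[OF assms(1,2,4,5)] assms(5)]
  by simp

lemma lca_isomorphic_refl: "lca_isomorphic scale S b S b"
  unfolding lca_isomorphic_def by (rule exI[of _ id]) (auto simp: dmod_hom_def map_poly_id)

lemma lca_isomorphic_trans:
  fixes scale :: "complex poly \<Rightarrow> 'e::ab_group_add \<Rightarrow> 'e"
  assumes "lca_isomorphic scale S b T c" and "lca_isomorphic scale T c U d"
    and "0 \<in> S" and "0 \<in> T"
  shows "lca_isomorphic scale S b U d"
proof -
  obtain f where f: "dmod_hom scale S T f" "bij_betw f S T"
      "\<And>x y. x \<in> S \<Longrightarrow> y \<in> S \<Longrightarrow> map_poly f (b x y) = c (f x) (f y)"
    using assms(1) unfolding lca_isomorphic_def by blast
  obtain g where g: "dmod_hom scale T U g" "bij_betw g T U"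
      "\<And>x y. x \<in> T \<Longrightarrow> y \<in> T \<Longrightarrow> map_poly g (c x y) = d (g x) (g y)"
    using assms(2) unfolding lca_isomorphic_def by blast
  have "map_poly (g \<circ> f) p = map_poly g (map_poly f p)" for p
    using dmod_hom_0[OF f(1) assms(3)] dmod_hom_0[OF g(1) assms(4)]
    by (intro poly_eqI) (simp add: coeff_map_poly)
  then have "\<forall>x\<in>S. \<forall>y\<in>S. map_poly (g \<circ> f) (b x y) = d ((g \<circ> f) x) ((g \<circ> f) y)"
    using f(3) g(3) dmod_homD(1)[OF f(1)] by simp
  moreover have "dmod_hom scale S U (g \<circ> f)"
    using f(1) g(1) by (auto simp: dmod_hom_def Pi_def)
  ultimately show ?thesis
    unfolding lca_isomorphic_def using bij_betw_trans[OF f(2) g(2)] by blast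
qed

text \<open>
  An isomorphism is inverted only on its domain \<open>S\<close>, so the coefficients of the bracket of \<open>S\<close> have to
  lie in \<open>S\<close> for the inverse to recover them.
\<close>

lemma lca_isomorphic_sym:
  fixes scale :: "complex poly \<Rightarrow> 'e::ab_group_add \<Rightarrow> 'e"
  assumes iso: "lca_isomorphic scale S b T c"
    and mod: "module scale" and sub: "module.subspace scale S"
    and closed: "\<And>x y. x \<in> S \<Longrightarrow> y \<in> S \<Longrightarrow> b x y \<in> polys_over S"
  shows "lca_isomorphic scale T c S b"
proof -
  obtain f where f: "dmod_hom scale S T f" "bij_betw f S T"
      "\<And>x y. x \<in> S \<Longrightarrow> y \<in> S \<Longrightarrow> map_poly f (b x y) = c (f x) (f y)"
    using iso unfolding lca_isomorphic_def by blast
  define g where "g = inv_into S f"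
  have bij: "bij_betw g T S"
    unfolding g_def by (rule bij_betw_inv_into[OF f(2)])
  have gS: "g x \<in> S" if "x \<in> T" for x
    using bij that by (rule bij_betw_apply)
  have gf: "g (f x) = x" if "x \<in> S" for x
    unfolding g_def using f(2) that by (rule bij_betw_inv_into_left)
  have fg: "f (g x) = x" if "x \<in> T" for x
    unfolding g_def using f(2) that by (rule bij_betw_inv_into_right)
  note S_0 = module.subspace_0[OF mod sub]
    and S_add = module.subspace_add[OF mod sub]
    and S_scale = module.subspace_scale[OF mod sub]
  note f_0 = dmod_hom_0[OF f(1) S_0]
  have hom: "dmod_hom scale T S g"
    unfolding dmod_hom_def
  proof (intro conjI ballI allI)
    show "g \<in> T \<rightarrow> S" using gS by blast
  next
    fix x y assume xy: "x \<in> T" "y \<in> T"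
    have "f (g x + g y) = x + y"
      using xy by (simp add: dmod_homD(2)[OF f(1)] gS fg)
    then show "g (x + y) = g x + g y"
      using gf[of "g x + g y"] xy gS S_add by simp
  next
    fix p x assume x: "x \<in> T"
    have "f (scale p (g x)) = scale p x"
      using x by (simp add: dmod_homD(3)[OF f(1)] gS fg)
    then show "g (scale p x) = scale p (g x)"
      using gf[of "scale p (g x)"] x gS S_scale by simp
  qed
  have "map_poly g (c x y) = b (g x) (g y)" if "x \<in> T" "y \<in> T" for x y
  proof -
    have "c x y = map_poly f (b (g x) (g y))"
      using f(3)[of "g x" "g y"] gS fg that by simp
    moreover have "coeff (b (g x) (g y)) n \<in> S" for n
      using closed[of "g x" "g y"] gS that by (simp add: polys_over_def)
    moreover have "g 0 = 0" using gf[OF S_0] f_0 by simp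
    ultimately show ?thesis
      by (intro poly_eqI) (simp add: coeff_map_poly f_0 gf)
  qed
  with hom bij show ?thesis
    unfolding lca_isomorphic_def by blast
qed

section \<open>Quotients by a pulled back equivalence relation\<close>

lemma equiv_pullback:
  assumes "equiv B s" and "g ` A \<subseteq> B"
  shows "equiv A {(a, a'). a \<in> A \<and> a' \<in> A \<and> (g a, g a') \<in> s}"
proof (rule equivI)
  show "refl_on A {(a, a'). a \<in> A \<and> a' \<in> A \<and> (g a, g a') \<in> s}"
    using assms by (auto simp: equiv_def refl_on_def)
  show "sym {(a, a'). a \<in> A \<and> a' \<in> A \<and> (g a, g a') \<in> s}"
    using assms(1) by (auto simp: equiv_def sym_def)
  show "trans {(a, a'). a \<in> A \<and> a' \<in> A \<and> (g a, g a') \<in> s}"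
    using assms(1) by (auto simp: equiv_def trans_def)
qed auto

text \<open>
  The induced map sends a class to the saturation of its image; two classes with the same image are
  equal because the relation on the source is a full pullback.
\<close>

lemma quotient_pullback_bij:
  assumes s: "equiv B s" and g: "g ` A = B"
  defines "r \<equiv> {(a, a'). a \<in> A \<and> a' \<in> A \<and> (g a, g a') \<in> s}"
  obtains F where "\<And>a. a \<in> A \<Longrightarrow> F (r `` {a}) = s `` {g a}" and "bij_betw F (A // r) (B // s)"
proof
  let ?F = "\<lambda>X. s `` (g ` X)"
  have r: "equiv A r"
    unfolding r_def using s g by (intro equiv_pullback) auto
  show F_class: "?F (r `` {a}) = s `` {g a}" if "a \<in> A" for a
  proof
    show "?F (r `` {a}) \<subseteq> s `` {g a}"
      using s by (auto simp: r_def equiv_def trans_def)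
    show "s `` {g a} \<subseteq> ?F (r `` {a})"
      using equiv_class_self[OF r that] by auto
  qed
  show "bij_betw ?F (A // r) (B // s)"
  proof (rule bij_betw_imageI)
    show "inj_on ?F (A // r)"
    proof (rule inj_onI)
      fix X Y assume X: "X \<in> A // r" and Y: "Y \<in> A // r" and eq: "?F X = ?F Y"
      obtain a b where ab: "a \<in> A" "X = r `` {a}" "b \<in> A" "Y = r `` {b}"
        using X Y by (auto elim!: quotientE)
      then have "s `` {g a} = s `` {g b}"
        using eq F_class by simp
      then have "(g a, g b) \<in> s"
        using s g ab by (intro eq_equiv_class) auto
      then have "(a, b) \<in> r"
        using ab by (simp add: r_def)
      then show "X = Y"
        using equiv_class_eq[OF r] ab by simp
    qed
    have "A // r = (\<lambda>a. r `` {a}) ` A"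
      by (auto simp: quotient_def)
    then have "?F ` (A // r) = (\<lambda>a. s `` {g a}) ` A"
      by (simp only: image_image F_class cong: image_cong)
    also have "\<dots> = B // s"
      using g by (auto simp: quotient_def)
    finally show "?F ` (A // r) = B // s" .
  qed
qed

section \<open>Graphs of deformation maps\<close>

locale complemented_subalgebra = lie_conformal_algebra scale br
  for scale :: "complex poly \<Rightarrow> 'e::ab_group_add \<Rightarrow> 'e" and br :: "'e \<Rightarrow> 'e \<Rightarrow> 'e poly" +
  fixes R Q :: "'e set" and ltri rtri :: "'e \<Rightarrow> 'e \<Rightarrow> 'e poly"
  assumes R_subalgebra: "subalgebra scale br R"
    and Q_complement: "complement scale br R Q"
    and matched: "assoc_matched_pair br R Q ltri rtri"
begin

abbreviation "DM \<equiv> deformation_maps scale br Q R ltri rtri"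
abbreviation "dbr \<equiv> deformed_bracket scale br ltri"

definition graph_map :: "('e \<Rightarrow> 'e) \<Rightarrow> 'e \<Rightarrow> 'e"
  where "graph_map \<phi> x = \<phi> x + x"

definition graph :: "('e \<Rightarrow> 'e) \<Rightarrow> 'e set"
  where "graph \<phi> = graph_map \<phi> ` Q"

lemma R_sub: "subspace R" and R_closed: "a \<in> R \<Longrightarrow> b \<in> R \<Longrightarrow> br a b \<in> polys_over R"
  using R_subalgebra by (auto simp: subalgebra_def)

lemma complementD:
  assumes "complement scale br R P"
  shows "subspace P" and "x \<in> P \<Longrightarrow> y \<in> P \<Longrightarrow> br x y \<in> polys_over P"
    and "R \<inter> P = {0}" and "\<exists>a\<in>R. \<exists>x\<in>P. v = a + x"
  using assms by (auto simp: complement_def subalgebra_def)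

lemmas Q_sub = complementD(1)[OF Q_complement]
  and Q_closed = complementD(2)[OF Q_complement]
  and Q_inter = complementD(3)[OF Q_complement]
  and Q_span = complementD(4)[OF Q_complement]

lemmas module = module_axioms

lemma direct_sum_cancel:
  assumes "subspace P" "R \<inter> P = {0}" and "a \<in> R" "b \<in> R" "x \<in> P" "y \<in> P" and "a + x = b + y"
  shows "a = b" and "x = y"
proof -
  have eq: "a - b = y - x"
    using assms(7) by (simp add: algebra_simps)
  have "a - b \<in> R" using R_sub assms(3,4) by (rule subspace_diff)
  moreover have "a - b \<in> P" unfolding eq using assms(1,6,5) by (rule subspace_diff)
  ultimately have "a - b = 0" using assms(2) by blast
  then show "a = b" by simp
  then show "x = y" using assms(7) by simp
qed

lemma matchedD:
  assumes "x \<in> Q" "a \<in> R"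
  shows "rtri x a \<in> polys_over R" and "ltri x a \<in> polys_over Q" and "br x a = rtri x a + ltri x a"
  using matched assms by (auto simp: assoc_matched_pair_def)

lemma deformed_bracket_closed:
  assumes "\<phi> \<in> Q \<rightarrow> R" "x \<in> Q" "y \<in> Q"
  shows "dbr \<phi> x y \<in> polys_over Q"
  unfolding deformed_bracket_def using assms
  by (intro polys_over_diff[OF module Q_sub] polys_over_add[OF module Q_sub]
      at_neg_polys_over[OF module Q_sub] Q_closed matchedD(2)) auto

lemma map_poly_deformed_bracket:
  assumes f: "dmod_hom scale Q T f" and xy: "x \<in> Q" "y \<in> Q" and R: "\<phi> x \<in> R" "\<phi> y \<in> R"
  shows "map_poly f (dbr \<phi> x y) = map_poly f (br x y) + map_poly f (ltri x (\<phi> y))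
    - map_poly f (at_neg scale (ltri y (\<phi> x)))"
proof -
  note in_Q = Q_closed[OF xy] matchedD(2)[OF xy(1) R(2)]
    at_neg_polys_over[OF module Q_sub matchedD(2)[OF xy(2) R(1)]]
  show ?thesis
    unfolding deformed_bracket_def
    using map_poly_hom_diff[OF module Q_sub f polys_over_add[OF module Q_sub in_Q(1,2)] in_Q(3)]
      map_poly_hom_add[OF f subspace_0[OF Q_sub] in_Q(1,2)]
    by simp
qed

definition graph_R_part :: "('e \<Rightarrow> 'e) \<Rightarrow> 'e \<Rightarrow> 'e \<Rightarrow> 'e poly"
  where "graph_R_part \<phi> x y =
    br (\<phi> x) (\<phi> y) + rtri x (\<phi> y) - at_neg scale (rtri y (\<phi> x))"

lemma graph_R_part_closed:
  assumes "\<phi> \<in> Q \<rightarrow> R" "x \<in> Q" "y \<in> Q"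
  shows "graph_R_part \<phi> x y \<in> polys_over R"
  unfolding graph_R_part_def using assms
  by (intro polys_over_diff[OF module R_sub] polys_over_add[OF module R_sub]
      at_neg_polys_over[OF module R_sub] R_closed matchedD(1)) auto

text \<open>
  Bilinearity gives four brackets. The matched pair splits \<open>[x\<^sub>\<lambda> \<phi>(y)]\<close> into components; for
  \<open>[\<phi>(x)\<^sub>\<lambda> y]\<close>, whose arguments are in the opposite order, skew-symmetry is applied first, and this
  is where the values at \<open>-\<lambda>-\<partial>\<close> come from.
\<close>

lemma bracket_on_graph:
  assumes "\<phi> \<in> Q \<rightarrow> R" "x \<in> Q" "y \<in> Q"
  shows "br (graph_map \<phi> x) (graph_map \<phi> y) = graph_R_part \<phi> x y + dbr \<phi> x y"
proof -
  have \<phi>: "\<phi> x \<in> R" "\<phi> y \<in> R" using assms by auto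
  have "br (\<phi> x) y = - at_neg scale (rtri y (\<phi> x)) - at_neg scale (ltri y (\<phi> x))"
    unfolding skew[of "\<phi> x" y] matchedD(3)[OF assms(3) \<phi>(1)] at_neg_add[OF module] by simp
  moreover have "br x (\<phi> y) = rtri x (\<phi> y) + ltri x (\<phi> y)"
    using matchedD(3)[OF assms(2) \<phi>(2)] .
  ultimately show ?thesis
    by (simp add: graph_map_def add_left add_right graph_R_part_def deformed_bracket_def)
qed

lemma map_poly_graph_map:
  assumes "dmod_hom scale Q R \<phi>" and "p \<in> polys_over Q"
  shows "map_poly (graph_map \<phi>) p = map_poly \<phi> p + p"
  using dmod_hom_0[OF assms(1) subspace_0[OF Q_sub]]
  by (intro poly_eqI) (simp add: coeff_map_poly graph_map_def)

text \<open>
  The deformation equation, with its terms collected: \<open>\<phi>\<close> applied to the \<open>Q\<close>-component of a bracket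
  on the graph is the \<open>R\<close>-component.
\<close>

lemma deformation_maps_iff:
  "\<phi> \<in> DM \<longleftrightarrow> \<phi> \<in> extensional Q \<and> dmod_hom scale Q R \<phi>
    \<and> (\<forall>x\<in>Q. \<forall>y\<in>Q. map_poly \<phi> (dbr \<phi> x y) = graph_R_part \<phi> x y)"
proof -
  have "map_poly \<phi> (br x y) - br (\<phi> x) (\<phi> y)
        = map_poly \<phi> (at_neg scale (ltri y (\<phi> x))) - map_poly \<phi> (ltri x (\<phi> y))
          + rtri x (\<phi> y) - at_neg scale (rtri y (\<phi> x))
      \<longleftrightarrow> map_poly \<phi> (dbr \<phi> x y) = graph_R_part \<phi> x y"
    if \<phi>: "dmod_hom scale Q R \<phi>" and "x \<in> Q" "y \<in> Q" for x y
  proof -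
    have R: "\<phi> x \<in> R" "\<phi> y \<in> R" using dmod_homD(1)[OF \<phi>] that by auto
    have "map_poly \<phi> (dbr \<phi> x y) = map_poly \<phi> (br x y) + map_poly \<phi> (ltri x (\<phi> y))
        - map_poly \<phi> (at_neg scale (ltri y (\<phi> x)))"
      by (rule map_poly_deformed_bracket) (use R that in auto)
    then show ?thesis
      by (simp add: graph_R_part_def) (auto simp: algebra_simps)
  qed
  then show ?thesis
    unfolding deformation_maps_def by blast
qed

lemma DM_D:
  assumes "\<phi> \<in> DM"
  shows "dmod_hom scale Q R \<phi>" and "\<phi> \<in> Q \<rightarrow> R"
  using assms by (auto simp: deformation_maps_iff dmod_hom_def)

lemma graph_map_bracket:
  assumes "\<phi> \<in> DM" "x \<in> Q" "y \<in> Q"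
  shows "map_poly (graph_map \<phi>) (dbr \<phi> x y) = br (graph_map \<phi> x) (graph_map \<phi> y)"
  using assms DM_D[OF assms(1)]
  by (simp add: map_poly_graph_map deformed_bracket_closed bracket_on_graph deformation_maps_iff)

lemma graph_map_hom:
  assumes "dmod_hom scale Q R \<phi>"
  shows "dmod_hom scale Q (graph \<phi>) (graph_map \<phi>)"
  using dmod_homD(2,3)[OF assms]
  by (simp add: dmod_hom_def graph_map_def graph_def scale_right_distrib algebra_simps)

lemma graph_map_bij:
  assumes "\<phi> \<in> Q \<rightarrow> R"
  shows "bij_betw (graph_map \<phi>) Q (graph \<phi>)"
proof (rule bij_betw_imageI)
  show "inj_on (graph_map \<phi>) Q"
  proof (rule inj_onI)
    fix x y assume "x \<in> Q" "y \<in> Q" "graph_map \<phi> x = graph_map \<phi> y"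
    then show "x = y"
      using assms direct_sum_cancel(2)[OF Q_sub Q_inter, of "\<phi> x" "\<phi> y" x y]
      by (auto simp: graph_map_def)
  qed
qed (simp add: graph_def)

lemma graph_isomorphic:
  assumes "\<phi> \<in> DM"
  shows "lca_isomorphic scale Q (dbr \<phi>) (graph \<phi>) br"
  unfolding lca_isomorphic_def
  using graph_map_hom[OF DM_D(1)[OF assms]] graph_map_bij[OF DM_D(2)[OF assms]]
    graph_map_bracket[OF assms]
  by blast

lemma graph_complement:
  assumes "\<phi> \<in> DM"
  shows "complement scale br R (graph \<phi>)"
proof -
  note \<phi> = DM_D[OF assms]
  note hom = graph_map_hom[OF \<phi>(1)]
  have \<phi>_0: "\<phi> 0 = 0" using dmod_hom_0[OF \<phi>(1) subspace_0[OF Q_sub]] .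
  have sub: "subspace (graph \<phi>)"
  proof (rule subspaceI)
    have "graph_map \<phi> 0 \<in> graph \<phi>"
      unfolding graph_def using subspace_0[OF Q_sub] by (rule imageI)
    then show "0 \<in> graph \<phi>"
      by (simp add: graph_map_def \<phi>_0)
  next
    fix u v assume "u \<in> graph \<phi>" "v \<in> graph \<phi>"
    then obtain x y where "x \<in> Q" "u = graph_map \<phi> x" "y \<in> Q" "v = graph_map \<phi> y"
      by (auto simp: graph_def)
    then show "u + v \<in> graph \<phi>"
      using imageI[OF subspace_add[OF Q_sub, of x y], of "graph_map \<phi>"] dmod_homD(2)[OF hom, of x y]
      by (simp add: graph_def)
  next
    fix c u assume "u \<in> graph \<phi>"
    then obtain x where "x \<in> Q" "u = graph_map \<phi> x"
      by (auto simp: graph_def)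
    then show "scale c u \<in> graph \<phi>"
      using imageI[OF subspace_scale[OF Q_sub, of x c], of "graph_map \<phi>"] dmod_homD(3)[OF hom, of x c]
      by (simp add: graph_def)
  qed
  have closed: "br u v \<in> polys_over (graph \<phi>)" if uv: "u \<in> graph \<phi>" "v \<in> graph \<phi>" for u v
  proof -
    obtain x y where xy: "x \<in> Q" "u = graph_map \<phi> x" "y \<in> Q" "v = graph_map \<phi> y"
      using uv by (auto simp: graph_def)
    have "br u v = map_poly (graph_map \<phi>) (dbr \<phi> x y)"
      using graph_map_bracket[OF assms] xy by simp
    moreover have "graph_map \<phi> 0 = 0" by (simp add: graph_map_def \<phi>_0)
    moreover have "coeff (dbr \<phi> x y) n \<in> Q" for n
      using deformed_bracket_closed[OF \<phi>(2) xy(1,3)] by (simp add: polys_over_def)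
    ultimately show ?thesis
      by (simp add: polys_over_def coeff_map_poly graph_def)
  qed
  have inter: "R \<inter> graph \<phi> = {0}"
  proof
    show "R \<inter> graph \<phi> \<subseteq> {0}"
    proof
      fix v assume v: "v \<in> R \<inter> graph \<phi>"
      then obtain x where x: "x \<in> Q" "v = \<phi> x + x"
        by (auto simp: graph_def graph_map_def)
      have "x = 0"
        using x v \<phi>(2) subspace_0[OF Q_sub]
        by (auto intro: direct_sum_cancel(2)[OF Q_sub Q_inter, of "\<phi> x" v x 0])
      then show "v \<in> {0}" using x \<phi>_0 by simp
    qed
    show "{0} \<subseteq> R \<inter> graph \<phi>"
      using subspace_0[OF sub] subspace_0[OF R_sub] by simp
  qed
  have span: "\<exists>a\<in>R. \<exists>p\<in>graph \<phi>. v = a + p" for v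
  proof -
    obtain a x where ax: "a \<in> R" "x \<in> Q" "v = a + x" using Q_span[of v] by blast
    have "a - \<phi> x \<in> R" using ax \<phi>(2) subspace_diff[OF R_sub] by auto
    moreover have "v = (a - \<phi> x) + graph_map \<phi> x" by (simp add: ax graph_map_def)
    moreover have "graph_map \<phi> x \<in> graph \<phi>"
      unfolding graph_def using ax(2) by (rule imageI)
    ultimately show ?thesis by blast
  qed
  show ?thesis
    unfolding complement_def subalgebra_def using sub closed inter span by simp
qed

text \<open>
  Both \<open>P\<close> and \<open>Q\<close> meet every coset of \<open>R\<close> in exactly one element, and \<open>\<phi>(x)\<close> is the difference
  between the element of \<open>P\<close> in the coset of \<open>x\<close> and \<open>x\<close> itself. Uniqueness of this difference
  makes \<open>\<phi>\<close> linear. It is also what later identifies the \<open>R\<close>-component of an element of \<open>P\<close>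
  from its \<open>Q\<close>-component, hence its place in the conclusion.
\<close>

lemma complement_subspace_graph:
  assumes P: "subspace P" "R \<inter> P = {0}" "\<And>v. \<exists>a\<in>R. \<exists>p\<in>P. v = a + p"
  obtains \<phi> where "\<phi> \<in> extensional Q" "dmod_hom scale Q R \<phi>" "graph \<phi> = P"
    "\<And>a x. a \<in> R \<Longrightarrow> x \<in> Q \<Longrightarrow> a + x \<in> P \<Longrightarrow> a = \<phi> x"
proof -
  have "\<exists>a. a \<in> R \<and> a + x \<in> P" for x
  proof -
    obtain a p where "a \<in> R" "p \<in> P" "x = a + p" using P(3)[of x] by blast
    then have "- a \<in> R" "- a + x \<in> P" using subspace_neg[OF R_sub] by auto
    then show ?thesis by blast
  qed
  then obtain f where f: "\<And>x. f x \<in> R" "\<And>x. f x + x \<in> P" by metis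
  define \<phi> where "\<phi> = restrict f Q"
  have in_R: "\<phi> x \<in> R" and in_P: "\<phi> x + x \<in> P" if "x \<in> Q" for x
    using f that by (simp_all add: \<phi>_def)
  have unique: "a = \<phi> x" if "a \<in> R" "x \<in> Q" "a + x \<in> P" for a x
  proof -
    have "a - \<phi> x \<in> R" using that in_R subspace_diff[OF R_sub] by simp
    moreover have "a - \<phi> x \<in> P" using subspace_diff[OF P(1) that(3) in_P[OF that(2)]] by simp
    ultimately have "a - \<phi> x = 0" using P(2) by blast
    then show ?thesis by simp
  qed
  have hom: "dmod_hom scale Q R \<phi>"
    unfolding dmod_hom_def
  proof (intro conjI ballI allI)
    show "\<phi> \<in> Q \<rightarrow> R" using in_R by blast
  next
    fix x y assume xy: "x \<in> Q" "y \<in> Q"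
    have "(\<phi> x + \<phi> y) + (x + y) \<in> P"
      using subspace_add[OF P(1) in_P[OF xy(1)] in_P[OF xy(2)]] by (simp add: algebra_simps)
    then show "\<phi> (x + y) = \<phi> x + \<phi> y"
      using unique[of "\<phi> x + \<phi> y" "x + y"] xy in_R subspace_add[OF R_sub] subspace_add[OF Q_sub]
      by simp
  next
    fix c x assume x: "x \<in> Q"
    have "scale c (\<phi> x) + scale c x \<in> P"
      using subspace_scale[OF P(1) in_P[OF x], of c] by (simp add: scale_right_distrib)
    then show "\<phi> (scale c x) = scale c (\<phi> x)"
      using unique[of "scale c (\<phi> x)" "scale c x"] x in_R subspace_scale[OF R_sub]
        subspace_scale[OF Q_sub]
      by simp
  qed
  have "P \<subseteq> graph \<phi>"
  proof
    fix p assume p: "p \<in> P"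
    obtain a x where ax: "a \<in> R" "x \<in> Q" "p = a + x" using Q_span[of p] by blast
    then have "p = graph_map \<phi> x"
      using unique[of a x] p by (simp add: graph_map_def)
    then show "p \<in> graph \<phi>" using ax by (simp add: graph_def)
  qed
  then have "graph \<phi> = P"
    using in_P by (auto simp: graph_def graph_map_def)
  moreover have "\<phi> \<in> extensional Q"
    by (simp add: \<phi>_def)
  ultimately show thesis
    using that hom unique by blast
qed

text \<open>
  Closure of \<open>P\<close> under the bracket forces the deformation equation: each coefficient of the bracket
  of two elements of the graph lies in \<open>P\<close>, so its \<open>R\<close>-component is \<open>\<phi>\<close> of its \<open>Q\<close>-component.
\<close>

lemma complement_eq_graph:
  assumes P: "complement scale br R P"
  obtains \<phi> where "\<phi> \<in> DM" "graph \<phi> = P"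
proof -
  obtain \<phi> where \<phi>: "\<phi> \<in> extensional Q" "dmod_hom scale Q R \<phi>" "graph \<phi> = P"
    and unique: "\<And>a x. a \<in> R \<Longrightarrow> x \<in> Q \<Longrightarrow> a + x \<in> P \<Longrightarrow> a = \<phi> x"
    using complement_subspace_graph[OF complementD(1,3,4)[OF P]] by blast
  have \<phi>_fun: "\<phi> \<in> Q \<rightarrow> R" using \<phi>(2) by (simp add: dmod_hom_def)
  have "map_poly \<phi> (dbr \<phi> x y) = graph_R_part \<phi> x y" if xy: "x \<in> Q" "y \<in> Q" for x y
  proof (rule poly_eqI)
    fix n
    have "graph_map \<phi> x \<in> P" "graph_map \<phi> y \<in> P"
      using \<phi>(3) xy by (auto simp: graph_def)
    then have "graph_R_part \<phi> x y + dbr \<phi> x y \<in> polys_over P"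
      using complementD(2)[OF P] bracket_on_graph[OF \<phi>_fun xy] by metis
    then have "coeff (graph_R_part \<phi> x y) n + coeff (dbr \<phi> x y) n \<in> P"
      by (simp add: polys_over_def)
    then have "coeff (graph_R_part \<phi> x y) n = \<phi> (coeff (dbr \<phi> x y) n)"
      using graph_R_part_closed[OF \<phi>_fun xy] deformed_bracket_closed[OF \<phi>_fun xy]
      by (intro unique) (auto simp: polys_over_def)
    then show "coeff (map_poly \<phi> (dbr \<phi> x y)) n = coeff (graph_R_part \<phi> x y) n"
      using dmod_hom_0[OF \<phi>(2) subspace_0[OF Q_sub]] by (simp add: coeff_map_poly)
  qed
  then have "\<phi> \<in> DM"
    using \<phi>(1,2) by (simp add: deformation_maps_iff)
  then show thesis using that \<phi>(3) by blast
qed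

lemma graph_image: "graph ` DM = {P. complement scale br R P}"
  using graph_complement complement_eq_graph by blast

section \<open>Equivalence of deformation maps\<close>

lemma complement_iso_rel_equiv:
  "equiv {P. complement scale br R P} (complement_iso_rel scale br R)"
proof (rule equivI)
  show "refl_on {P. complement scale br R P} (complement_iso_rel scale br R)"
    by (auto simp: refl_on_def complement_iso_rel_def lca_isomorphic_refl)
  show "sym (complement_iso_rel scale br R)"
  proof (rule symI)
    fix P P' assume "(P, P') \<in> complement_iso_rel scale br R"
    then have P: "complement scale br R P" "complement scale br R P'"
      and iso: "lca_isomorphic scale P br P' br"
      by (auto simp: complement_iso_rel_def)
    have "lca_isomorphic scale P' br P br"
      using iso module complementD(1,2)[OF P(1)] by (rule lca_isomorphic_sym)
    then show "(P', P) \<in> complement_iso_rel scale br R"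
      using P by (simp add: complement_iso_rel_def)
  qed
  show "trans (complement_iso_rel scale br R)"
  proof (rule transI)
    fix P P' P'' assume "(P, P') \<in> complement_iso_rel scale br R"
      and "(P', P'') \<in> complement_iso_rel scale br R"
    then have P: "complement scale br R P" "complement scale br R P'" "complement scale br R P''"
      and iso: "lca_isomorphic scale P br P' br" "lca_isomorphic scale P' br P'' br"
      by (auto simp: complement_iso_rel_def)
    have "lca_isomorphic scale P br P'' br"
      using iso subspace_0[OF complementD(1)[OF P(1)]] subspace_0[OF complementD(1)[OF P(2)]]
      by (rule lca_isomorphic_trans)
    then show "(P, P'') \<in> complement_iso_rel scale br R"
      using P by (simp add: complement_iso_rel_def)
  qed
qed (auto simp: complement_iso_rel_def)

text \<open>
  The terms without \<open>\<alpha>\<close> outermost are those of \<open>[\<alpha>(x)\<^sub>\<lambda> \<alpha>(y)]\<^sub>\<psi>\<close>, and those with it are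
  \<open>\<alpha>\<close> applied to the terms of \<open>[x\<^sub>\<lambda> y]\<^sub>\<phi>\<close>.
\<close>

lemma deformation_equiv_iff:
  assumes \<phi>: "\<phi> \<in> Q \<rightarrow> R"
  shows "deformation_equiv scale br Q ltri \<phi> \<psi> \<longleftrightarrow> lca_isomorphic scale Q (dbr \<phi>) Q (dbr \<psi>)"
proof -
  have "map_poly \<alpha> (br x y) - br (\<alpha> x) (\<alpha> y)
        = ltri (\<alpha> x) (\<psi> (\<alpha> y)) - map_poly \<alpha> (ltri x (\<phi> y))
          - at_neg scale (ltri (\<alpha> y) (\<psi> (\<alpha> x))) + map_poly \<alpha> (at_neg scale (ltri y (\<phi> x)))
      \<longleftrightarrow> map_poly \<alpha> (dbr \<phi> x y) = dbr \<psi> (\<alpha> x) (\<alpha> y)"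
    if \<alpha>: "dmod_hom scale Q Q \<alpha>" and "x \<in> Q" "y \<in> Q" for \<alpha> x y
  proof -
    have R: "\<phi> x \<in> R" "\<phi> y \<in> R" using \<phi> that by auto
    have "map_poly \<alpha> (dbr \<phi> x y) = map_poly \<alpha> (br x y) + map_poly \<alpha> (ltri x (\<phi> y))
        - map_poly \<alpha> (at_neg scale (ltri y (\<phi> x)))"
      by (rule map_poly_deformed_bracket) (use R that in auto)
    then show ?thesis
      by (simp add: deformed_bracket_def) (auto simp: algebra_simps)
  qed
  then show ?thesis
    unfolding deformation_equiv_def lca_isomorphic_def by blast
qed

text \<open>The deformation may be replaced by the graph, which carries the bracket of \<open>E\<close> itself.\<close>

lemma isomorphic_graph_iff:
  assumes \<phi>: "\<phi> \<in> DM"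
  shows "lca_isomorphic scale Q (dbr \<phi>) T c \<longleftrightarrow> lca_isomorphic scale (graph \<phi>) br T c"
proof -
  note graph_0 = subspace_0[OF complementD(1)[OF graph_complement[OF \<phi>]]]
    and Q_0 = subspace_0[OF Q_sub]
  have "lca_isomorphic scale (graph \<phi>) br Q (dbr \<phi>)"
    using graph_isomorphic[OF \<phi>] module Q_sub deformed_bracket_closed[OF DM_D(2)[OF \<phi>]]
    by (rule lca_isomorphic_sym)
  then show ?thesis
    using lca_isomorphic_trans[OF graph_isomorphic[OF \<phi>] _ Q_0 graph_0]
      lca_isomorphic_trans[OF _ _ graph_0 Q_0]
    by metis
qed

lemma deformation_rel_pullback:
  "deformation_rel scale br Q R ltri rtri =
    {(\<phi>, \<psi>). \<phi> \<in> DM \<and> \<psi> \<in> DM \<and> (graph \<phi>, graph \<psi>) \<in> complement_iso_rel scale br R}"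
proof -
  have "deformation_equiv scale br Q ltri \<phi> \<psi> \<longleftrightarrow> lca_isomorphic scale (graph \<phi>) br (graph \<psi>) br"
    if \<phi>: "\<phi> \<in> DM" and \<psi>: "\<psi> \<in> DM" for \<phi> \<psi>
  proof -
    note graph_0 = subspace_0[OF complementD(1)[OF graph_complement[OF \<psi>]]]
      and Q_0 = subspace_0[OF Q_sub]
    have to_Q: "lca_isomorphic scale (graph \<psi>) br Q (dbr \<psi>)"
      using isomorphic_graph_iff[OF \<psi>] lca_isomorphic_refl by blast
    have "lca_isomorphic scale Q (dbr \<phi>) Q (dbr \<psi>)
        \<longleftrightarrow> lca_isomorphic scale Q (dbr \<phi>) (graph \<psi>) br"
      using lca_isomorphic_trans[OF _ to_Q Q_0 graph_0]
        lca_isomorphic_trans[OF _ graph_isomorphic[OF \<psi>] Q_0 Q_0]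
      by blast
    then show ?thesis
      using deformation_equiv_iff[OF DM_D(2)[OF \<phi>]] isomorphic_graph_iff[OF \<phi>] by simp
  qed
  then show ?thesis
    using graph_complement by (auto simp: deformation_rel_def complement_iso_rel_def)
qed

lemma complements_isomorphic_to_deformation:
  assumes "\<phi> \<in> DM"
  shows "complement_iso_rel scale br R `` {graph \<phi>} =
    {P. complement scale br R P \<and> lca_isomorphic scale Q (dbr \<phi>) P br}"
  using graph_complement[OF assms]
  by (auto simp: complement_iso_rel_def isomorphic_graph_iff[OF assms])

end

section \<open>Classification of complements\<close>

theorem theorem3p12:
  fixes scale :: "complex poly \<Rightarrow> 'e::ab_group_add \<Rightarrow> 'e"
    and br :: "'e \<Rightarrow> 'e \<Rightarrow> 'e poly"
    and R Q :: "'e set"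
    and ltri rtri :: "'e \<Rightarrow> 'e \<Rightarrow> 'e poly"
  assumes "lie_conformal_algebra scale br"
    and "subalgebra scale br R"
    and "complement scale br R Q"
    and "assoc_matched_pair br R Q ltri rtri"
  shows "equiv (deformation_maps scale br Q R ltri rtri) (deformation_rel scale br Q R ltri rtri)
    \<and> (\<exists>F. (\<forall>\<phi>\<in>deformation_maps scale br Q R ltri rtri.
              F (deformation_rel scale br Q R ltri rtri `` {\<phi>})
              = {P. complement scale br R P
                    \<and> lca_isomorphic scale Q (deformed_bracket scale br ltri \<phi>) P br})
          \<and> bij_betw F (HL2 scale br Q R ltri rtri) (complement_classes scale br R))"
proof -
  interpret complemented_subalgebra scale br R Q ltri rtri
    using assms by (simp add: complemented_subalgebra_def complemented_subalgebra_axioms_def)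
  have "equiv DM (deformation_rel scale br Q R ltri rtri)"
    unfolding deformation_rel_pullback
    using complement_iso_rel_equiv graph_image by (intro equiv_pullback) auto
  moreover obtain F where
    "\<And>\<phi>. \<phi> \<in> DM \<Longrightarrow> F (deformation_rel scale br Q R ltri rtri `` {\<phi>})
      = complement_iso_rel scale br R `` {graph \<phi>}"
    "bij_betw F (HL2 scale br Q R ltri rtri) (complement_classes scale br R)"
    unfolding deformation_rel_pullback HL2_def complement_classes_def
    using quotient_pullback_bij[OF complement_iso_rel_equiv graph_image] by blast
  ultimately show ?thesis
    using complements_isomorphic_to_deformation by auto
qed

end
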